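(* Let $A$ be a finite $1$-bounded involutive semiring and $M$ a finitely generated $A$-semimodule. Then $M$ is injective if and only if it is projective.
   Context: A $1$-bounded involutive semiring is an algebra $(A,\vee,\cdot,1,{\sim},-)$ such that $(A,\vee)$ is a join-semilattice (order $x\le y\iff x\vee y=y$) with top element $1$, $(A,\cdot,1)$ is a monoid, $\cdot$ distributes over $\vee$ on both sides, and, with $0=-1$, for all $x,y\in A$: $x\le y\iff x\cdot{\sim}y\le 0\iff -y\cdot x\le 0$. Then $0$ is the bottom element and $(A,\vee,0,\cdot,1)$ is an additively idempotent semiring (with $0x=0=x0$). A (left) $A$-semimodule is a commutative monoid $(M,+,0)$ with scalar multiplication $A\times M\to M$ satisfying $(ab)\cdot x=a\cdot(b\cdot x)$, $a\cdot(x+y)=a\cdot x+a\cdot y$, $(a+b)\cdot x=a\cdot x+b\cdot x$, $0_A\cdot x=0_M=a\cdot 0_M$, $1\cdot x=x$. Homomorphisms preserve addition and scalar multiplication. $E$ is injective if for every $A$-semimodule $M$, every subsemimodule $N\subseteq M$ and every homomorphism $\alpha:N\to E$ there is a homomorphism $\beta:M\to E$ extending $\alpha$. $P$ is projective if for every surjective homomorphism $\varphi:M\to N$ of $A$-semimodules and every homomorphism $\alpha:P\to N$ there is a homomorphism $\beta:P\to M$ with $\varphi\beta=\alpha$. *)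

theory Defs
  imports "HOL-Algebra.Module" "HOL.Hull"
begin

section \<open>1-bounded involutive semirings\<close>

text \<open>
  The join is the field \<^const>\<open>add\<close> of \<^typ>\<open>'a ring\<close>; \<open>rneg\<close> is the operation \<open>\<sim>\<close>
  (it occurs in \<open>x \<otimes> \<sim>y\<close>) and \<open>lneg\<close> is the operation \<open>-\<close> (it occurs in \<open>-y \<otimes> x\<close>).
  The field \<^const>\<open>zero\<close> is not a primitive of the signature: the axiom \<open>zero_eq\<close> below
  forces it to be the defined constant \<open>-1\<close>. That it is neutral for the join and
  absorbing for the product is derived, not assumed.
\<close>

record 'a inv_semiring = "'a ring" +
  rneg :: "'a \<Rightarrow> 'a"
  lneg :: "'a \<Rightarrow> 'a"

definition add_le :: "('a, 'r) ring_scheme \<Rightarrow> 'a \<Rightarrow> 'a \<Rightarrow> bool"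
  where "add_le A x y \<longleftrightarrow> x \<oplus>\<^bsub>A\<^esub> y = y"

locale bounded_involutive_semiring = monoid A for A (structure) +
  assumes join_closed:
      "\<lbrakk>x \<in> carrier A; y \<in> carrier A\<rbrakk> \<Longrightarrow> x \<oplus> y \<in> carrier A"
    and join_assoc:
      "\<lbrakk>x \<in> carrier A; y \<in> carrier A; z \<in> carrier A\<rbrakk> \<Longrightarrow> (x \<oplus> y) \<oplus> z = x \<oplus> (y \<oplus> z)"
    and join_comm:
      "\<lbrakk>x \<in> carrier A; y \<in> carrier A\<rbrakk> \<Longrightarrow> x \<oplus> y = y \<oplus> x"
    and join_idem:
      "x \<in> carrier A \<Longrightarrow> x \<oplus> x = x"
    and le_one:
      "x \<in> carrier A \<Longrightarrow> add_le A x \<one>"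
    and mult_join_distr_right:
      "\<lbrakk>x \<in> carrier A; y \<in> carrier A; z \<in> carrier A\<rbrakk> \<Longrightarrow> (x \<oplus> y) \<otimes> z = x \<otimes> z \<oplus> y \<otimes> z"
    and mult_join_distr_left:
      "\<lbrakk>x \<in> carrier A; y \<in> carrier A; z \<in> carrier A\<rbrakk> \<Longrightarrow> z \<otimes> (x \<oplus> y) = z \<otimes> x \<oplus> z \<otimes> y"
    and rneg_closed:
      "x \<in> carrier A \<Longrightarrow> rneg A x \<in> carrier A"
    and lneg_closed:
      "x \<in> carrier A \<Longrightarrow> lneg A x \<in> carrier A"
    and zero_eq:
      "\<zero> = lneg A \<one>"
    and le_iff_rneg:
      "\<lbrakk>x \<in> carrier A; y \<in> carrier A\<rbrakk> \<Longrightarrow> add_le A x y \<longleftrightarrow> add_le A (x \<otimes> rneg A y) \<zero>"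
    and le_iff_lneg:
      "\<lbrakk>x \<in> carrier A; y \<in> carrier A\<rbrakk> \<Longrightarrow> add_le A x y \<longleftrightarrow> add_le A (lneg A y \<otimes> x) \<zero>"
begin

lemma zero_in_carrier: "\<zero> \<in> carrier A"
  by (simp add: zero_eq lneg_closed)

lemma zero_le:
  assumes y: "y \<in> carrier A"
  shows "add_le A \<zero> y"
proof -
  have n: "lneg A y \<in> carrier A" by (simp add: y lneg_closed)
  have "lneg A y \<otimes> \<zero> \<oplus> \<zero> = (lneg A y \<oplus> \<one>) \<otimes> \<zero>"
    by (simp add: n zero_in_carrier mult_join_distr_right)
  also have "\<dots> = \<zero>"
    using le_one[OF n] by (simp add: add_le_def zero_in_carrier)
  finally have "add_le A (lneg A y \<otimes> \<zero>) \<zero>" by (simp add: add_le_def)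
  then show ?thesis using le_iff_lneg[OF zero_in_carrier y] by simp
qed

lemma zero_mult:
  assumes x: "x \<in> carrier A"
  shows "\<zero> \<otimes> x = \<zero>"
proof -
  have z: "\<zero> \<otimes> x \<in> carrier A" by (simp add: x zero_in_carrier)
  have "\<zero> \<otimes> x \<oplus> \<zero> = \<zero> \<otimes> (x \<oplus> \<one>)"
    by (simp add: x zero_in_carrier mult_join_distr_left)
  also have "\<dots> = \<zero>"
    using le_one[OF x] by (simp add: add_le_def zero_in_carrier)
  finally show ?thesis
    using zero_le[OF z] join_comm[OF z zero_in_carrier] by (simp add: add_le_def)
qed

lemma mult_zero:
  assumes x: "x \<in> carrier A"
  shows "x \<otimes> \<zero> = \<zero>"
proof -
  have z: "x \<otimes> \<zero> \<in> carrier A" by (simp add: x zero_in_carrier)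
  have "x \<otimes> \<zero> \<oplus> \<zero> = (x \<oplus> \<one>) \<otimes> \<zero>"
    by (simp add: x zero_in_carrier mult_join_distr_right)
  also have "\<dots> = \<zero>"
    using le_one[OF x] by (simp add: add_le_def zero_in_carrier)
  finally show ?thesis
    using zero_le[OF z] join_comm[OF z zero_in_carrier] by (simp add: add_le_def)
qed

end

sublocale bounded_involutive_semiring \<subseteq> semiring A
proof (intro semiring.intro abelian_monoidI semiring_axioms.intro)
  show "monoid A" by (rule monoid_axioms)
  show "\<zero> \<oplus> x = x" if "x \<in> carrier A" for x
    using zero_le[OF that] by (simp add: add_le_def)
  show "x \<oplus> y = y \<oplus> x" if "x \<in> carrier A" "y \<in> carrier A" for x y
    using that by (rule join_comm)
qed (simp_all add: join_closed zero_in_carrier join_assoc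
      mult_join_distr_left mult_join_distr_right zero_mult mult_zero)

section \<open>Semimodules\<close>

text \<open>
  As for \<^locale>\<open>module\<close>, the fields \<^const>\<open>mult\<close> and \<^const>\<open>one\<close> of the record
  \<^typ>\<open>('a, 'b) module\<close> play no role.
\<close>

locale semimodule = R?: semiring R + M?: abelian_monoid M
  for R (structure) and M (structure) +
  assumes smult_closed [simp, intro]:
      "\<lbrakk>a \<in> carrier R; x \<in> carrier M\<rbrakk> \<Longrightarrow> a \<odot>\<^bsub>M\<^esub> x \<in> carrier M"
    and smult_assoc:
      "\<lbrakk>a \<in> carrier R; b \<in> carrier R; x \<in> carrier M\<rbrakk> \<Longrightarrow>
        (a \<otimes> b) \<odot>\<^bsub>M\<^esub> x = a \<odot>\<^bsub>M\<^esub> (b \<odot>\<^bsub>M\<^esub> x)"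
    and smult_r_distr:
      "\<lbrakk>a \<in> carrier R; x \<in> carrier M; y \<in> carrier M\<rbrakk> \<Longrightarrow>
        a \<odot>\<^bsub>M\<^esub> (x \<oplus>\<^bsub>M\<^esub> y) = a \<odot>\<^bsub>M\<^esub> x \<oplus>\<^bsub>M\<^esub> a \<odot>\<^bsub>M\<^esub> y"
    and smult_l_distr:
      "\<lbrakk>a \<in> carrier R; b \<in> carrier R; x \<in> carrier M\<rbrakk> \<Longrightarrow>
        (a \<oplus> b) \<odot>\<^bsub>M\<^esub> x = a \<odot>\<^bsub>M\<^esub> x \<oplus>\<^bsub>M\<^esub> b \<odot>\<^bsub>M\<^esub> x"
    and smult_l_null [simp]:
      "x \<in> carrier M \<Longrightarrow> \<zero> \<odot>\<^bsub>M\<^esub> x = \<zero>\<^bsub>M\<^esub>"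
    and smult_r_null [simp]:
      "a \<in> carrier R \<Longrightarrow> a \<odot>\<^bsub>M\<^esub> \<zero>\<^bsub>M\<^esub> = \<zero>\<^bsub>M\<^esub>"
    and smult_one [simp]:
      "x \<in> carrier M \<Longrightarrow> \<one> \<odot>\<^bsub>M\<^esub> x = x"

definition subsemimodule ::
    "('a, 'r) ring_scheme \<Rightarrow> ('a, 'b, 's) module_scheme \<Rightarrow> 'b set \<Rightarrow> bool"
  where "subsemimodule A M N \<longleftrightarrow>
    N \<subseteq> carrier M \<and> \<zero>\<^bsub>M\<^esub> \<in> N \<and>
    (\<forall>x\<in>N. \<forall>y\<in>N. x \<oplus>\<^bsub>M\<^esub> y \<in> N) \<and>
    (\<forall>a\<in>carrier A. \<forall>x\<in>N. a \<odot>\<^bsub>M\<^esub> x \<in> N)"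

definition finitely_generated ::
    "('a, 'r) ring_scheme \<Rightarrow> ('a, 'b, 's) module_scheme \<Rightarrow> bool"
  where "finitely_generated A M \<longleftrightarrow>
    (\<exists>S. finite S \<and> S \<subseteq> carrier M \<and> subsemimodule A M hull S = carrier M)"

definition semimodule_hom ::
    "('a, 'r) ring_scheme \<Rightarrow> ('a, 'b, 's) module_scheme \<Rightarrow> ('a, 'c, 't) module_scheme
      \<Rightarrow> ('b \<Rightarrow> 'c) set"
  where "semimodule_hom A M N =
    {h \<in> carrier M \<rightarrow> carrier N.
      (\<forall>x\<in>carrier M. \<forall>y\<in>carrier M. h (x \<oplus>\<^bsub>M\<^esub> y) = h x \<oplus>\<^bsub>N\<^esub> h y) \<and>
      (\<forall>a\<in>carrier A. \<forall>x\<in>carrier M. h (a \<odot>\<^bsub>M\<^esub> x) = a \<odot>\<^bsub>N\<^esub> h x)}"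

section \<open>Injective and projective semimodules\<close>

text \<open>
  HOL cannot quantify over types inside a formula. The test semimodules in the two definitions
  therefore range over all semimodules whose carrier is an arbitrary subset of a type \<open>'u\<close>,
  which is a parameter of the definition and serves as a universe. It is independent
  of the type of the elements of the semimodule that is being tested. Only infinite \<open>'u\<close> are
  meaningful: a finite universe may contain too few test semimodules (if \<open>'u\<close> is
  \<^typ>\<open>unit\<close>, every semimodule passes both tests).
\<close>

definition injective_semimodule ::
    "'u itself \<Rightarrow> ('a, 'r) ring_scheme \<Rightarrow> ('a, 'b, 's) module_scheme \<Rightarrow> bool"
  where "injective_semimodule (_ :: 'u itself) A E \<longleftrightarrow>
    (\<forall>(M :: ('a, 'u) module) N \<alpha>.
      semimodule A M \<and> subsemimodule A M N \<and>
      \<alpha> \<in> semimodule_hom A (M\<lparr>carrier := N\<rparr>) E \<longrightarrow>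
      (\<exists>\<beta> \<in> semimodule_hom A M E. \<forall>x\<in>N. \<beta> x = \<alpha> x))"

definition projective_semimodule ::
    "'u itself \<Rightarrow> ('a, 'r) ring_scheme \<Rightarrow> ('a, 'b, 's) module_scheme \<Rightarrow> bool"
  where "projective_semimodule (_ :: 'u itself) A P \<longleftrightarrow>
    (\<forall>(M :: ('a, 'u) module) (N :: ('a, 'u) module) \<phi> \<alpha>.
      semimodule A M \<and> semimodule A N \<and>
      \<phi> \<in> semimodule_hom A M N \<and> \<phi> ` carrier M = carrier N \<and>
      \<alpha> \<in> semimodule_hom A P N \<longrightarrow>
      (\<exists>\<beta> \<in> semimodule_hom A P M. \<forall>x\<in>carrier P. \<phi> (\<beta> x) = \<alpha> x))"

end

theory Submission
  imports Defs
begin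

text \<open>
  Both properties are equivalent to \<open>M\<close> being a retract of the finite free semimodule
  \<open>A\<^sup>M\<close>; for projectivity this is the standard argument. For injectivity the key is that
  every subsemimodule \<open>K\<close> of \<open>M\<close> that is closed downwards determines a functional
  \<open>f : M \<rightarrow> A\<close> with \<open>a \<cdot> f x = 0 \<longleftrightarrow> a \<cdot> x \<in> K\<close>, and an element of \<open>A\<close> is determined by its left
  annihilator. Taking for \<open>K\<close> the principal downsets, which are subsemimodules because \<open>1\<close> is
  the top element, yields an embedding of \<open>M\<close> into \<open>A\<^sup>M\<close>; taking for \<open>K\<close> the downward closure of
  the kernel of a functional on a subsemimodule shows that \<open>A\<close>, hence \<open>A\<^sup>n\<close>, is injective.
  Finite semimodules are copied into the infinite universes of the test semimodules.
\<close>

section \<open>Homomorphisms of semimodules\<close>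

lemma semimodule_homI:
  assumes "\<And>x. x \<in> carrier M \<Longrightarrow> h x \<in> carrier N"
    and "\<And>x y. \<lbrakk>x \<in> carrier M; y \<in> carrier M\<rbrakk> \<Longrightarrow> h (x \<oplus>\<^bsub>M\<^esub> y) = h x \<oplus>\<^bsub>N\<^esub> h y"
    and "\<And>a x. \<lbrakk>a \<in> carrier A; x \<in> carrier M\<rbrakk> \<Longrightarrow> h (a \<odot>\<^bsub>M\<^esub> x) = a \<odot>\<^bsub>N\<^esub> h x"
  shows "h \<in> semimodule_hom A M N"
  using assms by (auto simp: semimodule_hom_def)

lemma
  assumes "h \<in> semimodule_hom A M N"
  shows semimodule_hom_closed: "x \<in> carrier M \<Longrightarrow> h x \<in> carrier N"
    and semimodule_hom_add:
      "\<lbrakk>x \<in> carrier M; y \<in> carrier M\<rbrakk> \<Longrightarrow> h (x \<oplus>\<^bsub>M\<^esub> y) = h x \<oplus>\<^bsub>N\<^esub> h y"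
    and semimodule_hom_smult:
      "\<lbrakk>a \<in> carrier A; x \<in> carrier M\<rbrakk> \<Longrightarrow> h (a \<odot>\<^bsub>M\<^esub> x) = a \<odot>\<^bsub>N\<^esub> h x"
  using assms by (auto simp: semimodule_hom_def)

text \<open>Preservation of zero is not part of \<open>semimodule_hom\<close>; it follows from
  homogeneity, since the zero of \<open>M\<close> is its own multiple by the scalar zero.\<close>

lemma semimodule_hom_zero:
  assumes "semimodule A M" and "semimodule A N" and h: "h \<in> semimodule_hom A M N"
  shows "h \<zero>\<^bsub>M\<^esub> = \<zero>\<^bsub>N\<^esub>"
proof -
  interpret M: semimodule A M by fact
  interpret N: semimodule A N by fact
  have "h \<zero>\<^bsub>M\<^esub> = h (\<zero>\<^bsub>A\<^esub> \<odot>\<^bsub>M\<^esub> \<zero>\<^bsub>M\<^esub>)" by simp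
  also have "\<dots> = \<zero>\<^bsub>N\<^esub>"
    using semimodule_hom_closed[OF h] by (subst semimodule_hom_smult[OF h]) simp_all
  finally show ?thesis .
qed

lemma semimodule_hom_comp:
  assumes "g \<in> semimodule_hom A M N" and "h \<in> semimodule_hom A N P"
  shows "h \<circ> g \<in> semimodule_hom A M P"
  using assms by (auto simp: semimodule_hom_def Pi_iff)

lemma subsemimodule_image:
  assumes "semimodule A M" and "semimodule A N" and h: "h \<in> semimodule_hom A M N"
  shows "subsemimodule A N (h ` carrier M)"
proof -
  interpret M: semimodule A M by fact
  have "\<zero>\<^bsub>N\<^esub> \<in> h ` carrier M"
    using semimodule_hom_zero[OF assms] by (metis M.M.zero_closed image_eqI)
  then show ?thesis
    by (auto simp: subsemimodule_def semimodule_hom_closed[OF h]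
        simp flip: semimodule_hom_add[OF h] semimodule_hom_smult[OF h])
qed

lemma semimodule_hom_inv_into:
  assumes "semimodule A M" and h: "h \<in> semimodule_hom A M N" and inj: "inj_on h (carrier M)"
  shows "inv_into (carrier M) h \<in> semimodule_hom A (N\<lparr>carrier := h ` carrier M\<rparr>) M"
proof -
  interpret M: semimodule A M by fact
  show ?thesis
    by (rule semimodule_homI)
      (auto simp: inj inv_into_into simp flip: semimodule_hom_add[OF h] semimodule_hom_smult[OF h])
qed

text \<open>Stated for additive maps because it is also applied to scaling by a fixed
  \<open>a\<close>, which need not be a homomorphism when multiplication is not commutative. For
  infinite \<open>I\<close> both sums are zero by convention.\<close>

lemma additive_finsum:
  assumes "abelian_monoid M" and "abelian_monoid N"
    and closed: "h \<in> carrier M \<rightarrow> carrier N"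
    and add: "\<And>x y. \<lbrakk>x \<in> carrier M; y \<in> carrier M\<rbrakk> \<Longrightarrow> h (x \<oplus>\<^bsub>M\<^esub> y) = h x \<oplus>\<^bsub>N\<^esub> h y"
    and zero: "h \<zero>\<^bsub>M\<^esub> = \<zero>\<^bsub>N\<^esub>"
    and f: "f \<in> I \<rightarrow> carrier M"
  shows "h (\<Oplus>\<^bsub>M\<^esub>i\<in>I. f i) = (\<Oplus>\<^bsub>N\<^esub>i\<in>I. h (f i))"
proof -
  interpret M: abelian_monoid M by fact
  interpret N: abelian_monoid N by fact
  show ?thesis
    using f
  proof (induction I rule: infinite_finite_induct)
    case (insert i I)
    then have "h (f i) \<in> carrier N" "(\<lambda>i. h (f i)) \<in> I \<rightarrow> carrier N"
      using closed by auto
    with insert show ?case by (simp add: add)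
  qed (simp_all add: zero)
qed

lemma semimodule_hom_finsum:
  assumes "semimodule A M" and "semimodule A N" and h: "h \<in> semimodule_hom A M N"
    and "f \<in> I \<rightarrow> carrier M"
  shows "h (\<Oplus>\<^bsub>M\<^esub>i\<in>I. f i) = (\<Oplus>\<^bsub>N\<^esub>i\<in>I. h (f i))"
proof (rule additive_finsum)
  show "abelian_monoid M" "abelian_monoid N"
    using assms(1,2) by (auto simp: semimodule_def)
qed (use assms semimodule_hom_zero[OF assms(1-3)] in \<open>auto simp: semimodule_hom_def\<close>)

section \<open>Transport of structure\<close>

text \<open>The structure is pushed forward along \<open>f\<close>, which is meant to be injective
  on the carrier. The result is a plain \<open>module\<close> record, the form in which the test
  semimodules of the two definitions are given.\<close>

definition transport :: "('b \<Rightarrow> 'c) \<Rightarrow> ('a, 'b, 's) module_scheme \<Rightarrow> ('a, 'c) module"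
  where "transport f M =
    \<lparr>carrier = f ` carrier M, mult = undefined, one = undefined, zero = f \<zero>\<^bsub>M\<^esub>,
     add = \<lambda>x y. f (inv_into (carrier M) f x \<oplus>\<^bsub>M\<^esub> inv_into (carrier M) f y),
     smult = \<lambda>a x. f (a \<odot>\<^bsub>M\<^esub> inv_into (carrier M) f x)\<rparr>"

lemma carrier_transport [simp]: "carrier (transport f M) = f ` carrier M"
  by (simp add: transport_def)

lemma semimodule_transport:
  assumes "semimodule A M" and "inj_on f (carrier M)"
  shows "semimodule A (transport f M)"
proof -
  interpret M: semimodule A M by fact
  show ?thesis
    by (intro semimodule.intro semimodule_axioms.intro abelian_monoidI M.R.semiring_axioms)
      (auto simp: transport_def assms(2) M.smult_assoc M.smult_r_distr M.smult_l_distr M.M.a_ac)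
qed

lemma transport_hom:
  assumes "inj_on f (carrier M)"
  shows "f \<in> semimodule_hom A M (transport f M)"
  by (rule semimodule_homI) (simp_all add: transport_def assms)

lemma transport_inv_hom:
  assumes "semimodule A M" and "inj_on f (carrier M)"
  shows "inv_into (carrier M) f \<in> semimodule_hom A (transport f M) M"
proof -
  \<comment> \<open>The carrier of the copy is exactly the image of \<open>f\<close>, so restricting
    to that image changes nothing.\<close>
  have eq: "(transport f M)\<lparr>carrier := f ` carrier M\<rparr> = transport f M"
    by (simp add: transport_def)
  show ?thesis
    using semimodule_hom_inv_into[OF assms(1) transport_hom[OF assms(2)] assms(2)]
    unfolding eq .
qed

lemma ex_inj_on_infinite:
  assumes "finite S" and "infinite (UNIV :: 'u set)"
  shows "\<exists>f :: 'b \<Rightarrow> 'u. inj_on f S"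
proof -
  obtain B :: "'u set" where "finite B" "card B = card S"
    using infinite_arbitrarily_large[OF assms(2)] by blast
  then show ?thesis
    using finite_same_card_bij[OF assms(1)] by (metis bij_betw_imp_inj_on)
qed

section \<open>Splitting of embeddings and surjections of finite semimodules\<close>

text \<open>The inverse of the embedding is a homomorphism on the image of \<open>E\<close> in a
  copy of \<open>L\<close>; extending it to the whole copy gives the retraction. Only
  \<open>L\<close> is copied into \<open>'u\<close>, since the target \<open>E\<close> of the
  extension problem may live in any type.\<close>

lemma injective_semimodule_split:
  fixes E :: "('a, 'e, 's) module_scheme" and L :: "('a, 'l, 't) module_scheme"
  assumes E: "injective_semimodule TYPE('u) A E" "infinite (UNIV :: 'u set)" "semimodule A E"
    and L: "semimodule A L" "finite (carrier L)"
    and h: "h \<in> semimodule_hom A E L" "inj_on h (carrier E)"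
  shows "\<exists>r \<in> semimodule_hom A L E. \<forall>x\<in>carrier E. r (h x) = x"
proof -
  obtain e :: "'l \<Rightarrow> 'u" where e: "inj_on e (carrier L)"
    using ex_inj_on_infinite[OF L(2) E(2)] by blast
  let ?T = "transport e L" and ?k = "e \<circ> h"
  have T: "semimodule A ?T" by (rule semimodule_transport[OF L(1) e])
  have k: "?k \<in> semimodule_hom A E ?T"
    by (rule semimodule_hom_comp[OF h(1) transport_hom[OF e]])
  have inj: "inj_on ?k (carrier E)"
    using semimodule_hom_closed[OF h(1)] by (intro comp_inj_on h inj_on_subset[OF e]) auto
  obtain r where r: "r \<in> semimodule_hom A ?T E"
    "\<forall>x \<in> ?k ` carrier E. r x = inv_into (carrier E) ?k x"
    using E(1) T subsemimodule_image[OF E(3) T k] semimodule_hom_inv_into[OF E(3) k inj]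
    unfolding injective_semimodule_def by metis
  have "(r \<circ> e) (h x) = x" if "x \<in> carrier E" for x
    using that r(2) inv_into_f_f[OF inj that] by auto
  with semimodule_hom_comp[OF transport_hom[OF e] r(1)] show ?thesis by blast
qed

text \<open>The isomorphism \<open>d\<close> from \<open>P\<close> to its copy is lifted along the
  copy of \<open>h\<close>. Here both \<open>L\<close> and \<open>P\<close> are copied, because
  source and target of the test surjection have to live in \<open>'v\<close>.\<close>

lemma projective_semimodule_split:
  fixes P :: "('a, 'p, 's) module_scheme" and L :: "('a, 'l, 't) module_scheme"
  assumes P: "projective_semimodule TYPE('v) A P" "infinite (UNIV :: 'v set)" "semimodule A P"
      "finite (carrier P)"
    and L: "semimodule A L" "finite (carrier L)"
    and h: "h \<in> semimodule_hom A L P" "h ` carrier L = carrier P"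
  shows "\<exists>s \<in> semimodule_hom A P L. \<forall>x\<in>carrier P. h (s x) = x"
proof -
  obtain e :: "'l \<Rightarrow> 'v" where e: "inj_on e (carrier L)"
    using ex_inj_on_infinite[OF L(2) P(2)] by blast
  obtain d :: "'p \<Rightarrow> 'v" where d: "inj_on d (carrier P)"
    using ex_inj_on_infinite[OF P(4) P(2)] by blast
  let ?g = "inv_into (carrier L) e"
  let ?k = "d \<circ> (h \<circ> ?g)"
  have g: "?g \<in> semimodule_hom A (transport e L) L" by (rule transport_inv_hom[OF L(1) e])
  have k: "?k \<in> semimodule_hom A (transport e L) (transport d P)"
    by (intro semimodule_hom_comp[OF _ transport_hom[OF d]] semimodule_hom_comp[OF g h(1)])
  have surj: "?k ` carrier (transport e L) = carrier (transport d P)"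
    by (simp add: image_image e flip: h(2))
  obtain s where s: "s \<in> semimodule_hom A P (transport e L)" "\<forall>x\<in>carrier P. ?k (s x) = d x"
    using P(1) semimodule_transport[OF L(1) e] semimodule_transport[OF P(3) d] k surj
      transport_hom[OF d]
    unfolding projective_semimodule_def by metis
  have s': "?g \<circ> s \<in> semimodule_hom A P L"
    by (rule semimodule_hom_comp[OF s(1) g])
  \<comment> \<open>The lifting property reads \<open>d (h (?g (s x))) = d x\<close>, and
    \<open>d\<close> can be cancelled.\<close>
  have "h ((?g \<circ> s) x) = x" if x: "x \<in> carrier P" for x
    using s(2) x semimodule_hom_closed[OF h(1) semimodule_hom_closed[OF s' x]]
    by (auto dest: inj_onD[OF d])
  with s' show ?thesis by blast
qed

section \<open>Free semimodules\<close>

definition regular_semimodule :: "('a, 'r) ring_scheme \<Rightarrow> ('a, 'a) module"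
  where "regular_semimodule A =
    \<lparr>carrier = carrier A, mult = mult A, one = one A, zero = zero A, add = add A,
     smult = mult A\<rparr>"

text \<open>Extensional functions make equality of elements the same as equality of the coordinates
  in \<open>X\<close>. For infinite \<open>X\<close> this is the full power of \<open>A\<close>;
  freeness on the basis vectors is used for finite \<open>X\<close> only.\<close>

definition free_semimodule :: "('a, 'r) ring_scheme \<Rightarrow> 'x set \<Rightarrow> ('a, 'x \<Rightarrow> 'a) module"
  where "free_semimodule A X =
    \<lparr>carrier = X \<rightarrow>\<^sub>E carrier A, mult = undefined, one = undefined, zero = \<lambda>x\<in>X. \<zero>\<^bsub>A\<^esub>,
     add = \<lambda>c d. \<lambda>x\<in>X. c x \<oplus>\<^bsub>A\<^esub> d x, smult = \<lambda>a c. \<lambda>x\<in>X. a \<otimes>\<^bsub>A\<^esub> c x\<rparr>"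

definition basis_vector :: "('a, 'r) ring_scheme \<Rightarrow> 'x set \<Rightarrow> 'x \<Rightarrow> 'x \<Rightarrow> 'a"
  where "basis_vector A X x = (\<lambda>y\<in>X. if x = y then \<one>\<^bsub>A\<^esub> else \<zero>\<^bsub>A\<^esub>)"

definition linear_combination ::
    "('a, 'b, 's) module_scheme \<Rightarrow> 'x set \<Rightarrow> ('x \<Rightarrow> 'b) \<Rightarrow> ('x \<Rightarrow> 'a) \<Rightarrow> 'b"
  where "linear_combination M X g c = (\<Oplus>\<^bsub>M\<^esub>x\<in>X. c x \<odot>\<^bsub>M\<^esub> g x)"

lemma regular_semimodule_simps [simp]:
  "carrier (regular_semimodule A) = carrier A"
  "zero (regular_semimodule A) = zero A"
  "add (regular_semimodule A) = add A"
  "smult (regular_semimodule A) = mult A"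
  by (simp_all add: regular_semimodule_def)

lemma carrier_free_semimodule [simp]:
  "carrier (free_semimodule A X) = X \<rightarrow>\<^sub>E carrier A"
  by (simp add: free_semimodule_def)

lemma finite_free_semimodule:
  "\<lbrakk>finite X; finite (carrier A)\<rbrakk> \<Longrightarrow> finite (carrier (free_semimodule A X))"
  by (simp add: finite_PiE)

context semiring
begin

lemma regular_semimodule: "semimodule R (regular_semimodule R)"
  by (intro semimodule.intro semimodule_axioms.intro abelian_monoidI semiring_axioms)
    (auto simp: m_assoc r_distr l_distr a_ac)

lemma free_semimodule: "semimodule R (free_semimodule R X)"
proof -
  have eqI: "(\<lambda>x\<in>X. f x) = c" if "c \<in> extensional X" "\<And>x. x \<in> X \<Longrightarrow> f x = c x"
    for f and c :: "_ \<Rightarrow> 'a"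
    using that by (metis extensional_restrict restrict_ext)
  show ?thesis
    by (intro semimodule.intro semimodule_axioms.intro abelian_monoidI semiring_axioms)
      (auto simp: free_semimodule_def PiE_iff m_assoc r_distr l_distr a_ac intro!: eqI)
qed

lemma free_semimodule_coordinate:
  assumes "x \<in> X"
  shows "(\<lambda>c. c x) \<in> semimodule_hom R (free_semimodule R X) (regular_semimodule R)"
  using assms by (intro semimodule_homI) (auto simp: free_semimodule_def)

lemma free_semimodule_homI:
  assumes "\<And>x. x \<in> X \<Longrightarrow> (\<lambda>m. f m x) \<in> semimodule_hom R M (regular_semimodule R)"
  shows "(\<lambda>m. \<lambda>x\<in>X. f m x) \<in> semimodule_hom R M (free_semimodule R X)"
proof (rule semimodule_homI)
  fix m assume "m \<in> carrier M"
  then show "(\<lambda>x\<in>X. f m x) \<in> carrier (free_semimodule R X)"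
    using semimodule_hom_closed[OF assms] by simp
qed (auto simp: free_semimodule_def fun_eq_iff semimodule_hom_add[OF assms]
      semimodule_hom_smult[OF assms])

lemma basis_vector_closed: "basis_vector R X x \<in> carrier (free_semimodule R X)"
  by (auto simp: basis_vector_def)

lemma linear_combination_hom:
  assumes "semimodule R M" and g: "g \<in> X \<rightarrow> carrier M"
  shows "linear_combination M X g \<in> semimodule_hom R (free_semimodule R X) M"
proof -
  interpret M: semimodule R M by fact
  have closed: "(\<lambda>x. c x \<odot>\<^bsub>M\<^esub> g x) \<in> X \<rightarrow> carrier M" if "c \<in> X \<rightarrow>\<^sub>E carrier R" for c
    using g that by fastforce
  show ?thesis
  proof (rule semimodule_homI)
    fix c assume "c \<in> carrier (free_semimodule R X)"
    then show "linear_combination M X g c \<in> carrier M"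
      using closed by (simp add: linear_combination_def)
  next
    fix c d assume cd: "c \<in> carrier (free_semimodule R X)" "d \<in> carrier (free_semimodule R X)"
    have "linear_combination M X g (c \<oplus>\<^bsub>free_semimodule R X\<^esub> d) =
        (\<Oplus>\<^bsub>M\<^esub>x\<in>X. c x \<odot>\<^bsub>M\<^esub> g x \<oplus>\<^bsub>M\<^esub> d x \<odot>\<^bsub>M\<^esub> g x)"
      unfolding linear_combination_def
      using cd g by (intro M.M.finsum_cong')
        (auto simp: free_semimodule_def PiE_mem Pi_mem intro!: M.smult_l_distr M.smult_closed)
    also have "\<dots> = linear_combination M X g c \<oplus>\<^bsub>M\<^esub> linear_combination M X g d"
      using closed cd by (simp add: linear_combination_def M.M.finsum_addf)
    finally show "linear_combination M X g (c \<oplus>\<^bsub>free_semimodule R X\<^esub> d) =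
        linear_combination M X g c \<oplus>\<^bsub>M\<^esub> linear_combination M X g d" .
  next
    fix a c assume ac: "a \<in> carrier R" "c \<in> carrier (free_semimodule R X)"
    have "linear_combination M X g (a \<odot>\<^bsub>free_semimodule R X\<^esub> c) =
        (\<Oplus>\<^bsub>M\<^esub>x\<in>X. a \<odot>\<^bsub>M\<^esub> (c x \<odot>\<^bsub>M\<^esub> g x))"
      unfolding linear_combination_def
      using ac g by (intro M.M.finsum_cong')
        (auto simp: free_semimodule_def PiE_mem Pi_mem intro!: M.smult_assoc M.smult_closed)
    also have "\<dots> = a \<odot>\<^bsub>M\<^esub> linear_combination M X g c"
      unfolding linear_combination_def
      using ac closed[of c]
      by (intro additive_finsum[symmetric, where h = "\<lambda>y. a \<odot>\<^bsub>M\<^esub> y"] M.M.abelian_monoid_axioms)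
        (auto simp: M.smult_r_distr)
    finally show "linear_combination M X g (a \<odot>\<^bsub>free_semimodule R X\<^esub> c) =
        a \<odot>\<^bsub>M\<^esub> linear_combination M X g c" .
  qed
qed

lemma linear_combination_basis_vector:
  assumes "semimodule R M" and "finite X" and g: "g \<in> X \<rightarrow> carrier M" and "x \<in> X"
  shows "linear_combination M X g (basis_vector R X x) = g x"
proof -
  interpret M: semimodule R M by fact
  have "linear_combination M X g (basis_vector R X x) =
      (\<Oplus>\<^bsub>M\<^esub>y\<in>X. if x = y then g y else \<zero>\<^bsub>M\<^esub>)"
    unfolding linear_combination_def
    using g funcset_mem[OF g] by (intro M.M.finsum_cong') (auto simp: basis_vector_def)
  also have "\<dots> = g x"
    using M.M.finsum_singleton[OF \<open>x \<in> X\<close> \<open>finite X\<close> g] .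
  finally show ?thesis .
qed

text \<open>Uniqueness of linear extension: \<open>c\<close> is the sum of the basis vectors
  weighted by its coordinates, and \<open>h\<close> commutes with that sum.\<close>

lemma free_semimodule_hom_eq:
  assumes M: "semimodule R M" and X: "finite X"
    and h: "h \<in> semimodule_hom R (free_semimodule R X) M"
    and c: "c \<in> carrier (free_semimodule R X)"
  shows "h c = linear_combination M X (\<lambda>x. h (basis_vector R X x)) c"
proof -
  let ?F = "free_semimodule R X" and ?b = "basis_vector R X"
  interpret F: semimodule R ?F by (rule free_semimodule)
  interpret M: semimodule R M by fact
  have cX: "c x \<in> carrier R" if "x \<in> X" for x using c that by auto
  have cb: "(\<lambda>x. c x \<odot>\<^bsub>?F\<^esub> ?b x) \<in> X \<rightarrow> carrier ?F"
    using cX basis_vector_closed by (intro Pi_I F.smult_closed)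
  have "(\<Oplus>\<^bsub>?F\<^esub>x\<in>X. c x \<odot>\<^bsub>?F\<^esub> ?b x) = c"
  proof (rule PiE_ext)
    show "(\<Oplus>\<^bsub>?F\<^esub>x\<in>X. c x \<odot>\<^bsub>?F\<^esub> ?b x) \<in> X \<rightarrow>\<^sub>E carrier R"
      using F.M.finsum_closed[OF cb] by simp
    show "c \<in> X \<rightarrow>\<^sub>E carrier R" using c by simp
    fix y assume y: "y \<in> X"
    \<comment> \<open>Taking the coordinate at \<open>y\<close> is a homomorphism, so the sum of
      functions can be evaluated termwise.\<close>
    have "(\<Oplus>\<^bsub>?F\<^esub>x\<in>X. c x \<odot>\<^bsub>?F\<^esub> ?b x) y =
        (\<Oplus>\<^bsub>regular_semimodule R\<^esub>x\<in>X. (c x \<odot>\<^bsub>?F\<^esub> ?b x) y)"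
      by (rule semimodule_hom_finsum[OF free_semimodule regular_semimodule
            free_semimodule_coordinate[OF y] cb])
    \<comment> \<open>Sums depend only on carrier, zero and addition, which \<open>R\<close> and its
      regular semimodule share.\<close>
    also have "\<dots> = (\<Oplus>\<^bsub>R\<^esub>x\<in>X. (c x \<odot>\<^bsub>?F\<^esub> ?b x) y)"
      by (simp add: finsum_def finprod_def)
    also have "\<dots> = (\<Oplus>\<^bsub>R\<^esub>x\<in>X. if y = x then c x else \<zero>\<^bsub>R\<^esub>)"
      using cX y by (intro finsum_cong') (auto simp: free_semimodule_def basis_vector_def)
    also have "\<dots> = c y"
      using cX by (intro finsum_singleton[OF y X]) auto
    finally show "(\<Oplus>\<^bsub>?F\<^esub>x\<in>X. c x \<odot>\<^bsub>?F\<^esub> ?b x) y = c y" .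
  qed
  then have "h c = h (\<Oplus>\<^bsub>?F\<^esub>x\<in>X. c x \<odot>\<^bsub>?F\<^esub> ?b x)" by simp
  also have "\<dots> = (\<Oplus>\<^bsub>M\<^esub>x\<in>X. h (c x \<odot>\<^bsub>?F\<^esub> ?b x))"
    by (rule semimodule_hom_finsum[OF free_semimodule M h cb])
  also have "\<dots> = linear_combination M X (\<lambda>x. h (?b x)) c"
    unfolding linear_combination_def
  proof (rule M.M.finsum_cong')
    show "(\<lambda>x. c x \<odot>\<^bsub>M\<^esub> h (?b x)) \<in> X \<rightarrow> carrier M"
      using cX semimodule_hom_closed[OF h basis_vector_closed] by (intro Pi_I M.smult_closed)
  qed (simp_all add: semimodule_hom_smult[OF h cX basis_vector_closed])
  finally show ?thesis .
qed

text \<open>Every \<open>x\<close> is the image of its own basis vector, all elements of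
  \<open>M\<close> being taken as generators.\<close>

lemma linear_combination_surj:
  assumes "semimodule R M" and "finite (carrier M)"
  shows "linear_combination M (carrier M) (\<lambda>x. x) ` carrier (free_semimodule R (carrier M)) =
    carrier M"
proof (intro equalityI subsetI)
  let ?l = "linear_combination M (carrier M) (\<lambda>x. x)"
    and ?F = "free_semimodule R (carrier M)"
  have l: "?l \<in> semimodule_hom R ?F M" by (rule linear_combination_hom[OF assms(1)]) simp
  fix x
  show "x \<in> carrier M" if "x \<in> ?l ` carrier ?F"
    using that semimodule_hom_closed[OF l] by blast
  show "x \<in> ?l ` carrier ?F" if "x \<in> carrier M"
    using linear_combination_basis_vector[OF assms, of "\<lambda>x. x" x] basis_vector_closed that
    by (metis Pi_I image_eqI)
qed

text \<open>The linear combinations of the generators form a subsemimodule containing them, hence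
  all of \<open>M\<close>, and over finitely many scalars there are finitely many such
  combinations.\<close>

lemma finitely_generated_imp_finite:
  assumes M: "semimodule R M" and "finitely_generated R M" and "finite (carrier R)"
  shows "finite (carrier M)"
proof -
  obtain S where S: "finite S" "S \<subseteq> carrier M" "subsemimodule R M hull S = carrier M"
    using assms(2) by (auto simp: finitely_generated_def)
  let ?l = "linear_combination M S (\<lambda>x. x)" and ?F = "free_semimodule R S"
  have id: "(\<lambda>x. x) \<in> S \<rightarrow> carrier M" using S(2) by auto
  have "subsemimodule R M (?l ` carrier ?F)"
    by (rule subsemimodule_image[OF free_semimodule M linear_combination_hom[OF M id]])
  moreover have "S \<subseteq> ?l ` carrier ?F"
    using linear_combination_basis_vector[OF M S(1) id] basis_vector_closed
    by (metis image_eqI subsetI)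
  ultimately have "carrier M \<subseteq> ?l ` carrier ?F"
    using S(3) by (metis hull_minimal)
  then show ?thesis
    using finite_free_semimodule[OF S(1) assms(3)] by (meson finite_imageI finite_subset)
qed

section \<open>Retracts of finite free semimodules and projectivity\<close>

text \<open>No universe type occurs in this condition, so it can mediate between injectivity over
  \<open>'u\<close> and projectivity over \<open>'v\<close>.\<close>

definition finite_free_retract :: "('a, 'm, 's) module_scheme \<Rightarrow> 'x set \<Rightarrow> bool"
  where "finite_free_retract M X \<longleftrightarrow> finite X \<and>
    (\<exists>i \<in> semimodule_hom R M (free_semimodule R X). \<exists>p \<in> semimodule_hom R (free_semimodule R X) M.
      \<forall>x\<in>carrier M. p (i x) = x)"

text \<open>The composite \<open>\<alpha> \<circ> p\<close> is lifted on basis vectors by choosing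
  preimages under \<open>\<phi>\<close>; the linear extension of this choice, restricted along
  \<open>i\<close>, lifts \<open>\<alpha>\<close> itself.\<close>

lemma finite_free_retract_imp_projective:
  assumes "finite_free_retract M X"
  shows "projective_semimodule TYPE('v) R M"
proof -
  let ?F = "free_semimodule R X" and ?b = "basis_vector R X"
  obtain i p where X: "finite X" and i: "i \<in> semimodule_hom R M ?F"
    and p: "p \<in> semimodule_hom R ?F M" and pi: "\<forall>x\<in>carrier M. p (i x) = x"
    using assms by (auto simp: finite_free_retract_def)
  have "\<exists>\<beta> \<in> semimodule_hom R M L. \<forall>x\<in>carrier M. \<phi> (\<beta> x) = \<alpha> x"
    if L: "semimodule R L" and N: "semimodule R N" and \<phi>: "\<phi> \<in> semimodule_hom R L N"
      and surj: "\<phi> ` carrier L = carrier N" and \<alpha>: "\<alpha> \<in> semimodule_hom R M N"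
    for L N :: "('a, 'v) module" and \<phi> \<alpha>
  proof -
    have h: "\<alpha> \<circ> p \<in> semimodule_hom R ?F N" by (rule semimodule_hom_comp[OF p \<alpha>])
    define g where "g x = inv_into (carrier L) \<phi> (\<alpha> (p (?b x)))" for x
    have bN: "\<alpha> (p (?b x)) \<in> \<phi> ` carrier L" for x
      unfolding surj using semimodule_hom_closed[OF h basis_vector_closed] by simp
    have gL: "g \<in> X \<rightarrow> carrier L" and \<phi>g: "\<phi> (g x) = (\<alpha> \<circ> p) (?b x)" for x
      using bN by (auto simp: g_def inv_into_into f_inv_into_f)
    let ?l = "linear_combination L X g"
    have l: "?l \<in> semimodule_hom R ?F L" by (rule linear_combination_hom[OF L gL])
    \<comment> \<open>Both sides are homomorphisms on the free semimodule, hence determined by their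
      values on basis vectors, where they agree by the choice of \<open>g\<close>.\<close>
    have \<phi>l: "\<phi> (?l c) = \<alpha> (p c)" if c: "c \<in> carrier ?F" for c
    proof -
      have "(\<phi> \<circ> ?l) c = linear_combination N X (\<lambda>x. (\<phi> \<circ> ?l) (?b x)) c"
        by (rule free_semimodule_hom_eq[OF N X semimodule_hom_comp[OF l \<phi>] c])
      also have "\<dots> = linear_combination N X (\<lambda>x. (\<alpha> \<circ> p) (?b x)) c"
      proof -
        interpret N: semimodule R N by fact
        show ?thesis
          unfolding linear_combination_def[of N]
        proof (rule N.M.finsum_cong')
          show "(\<lambda>x. c x \<odot>\<^bsub>N\<^esub> (\<alpha> \<circ> p) (?b x)) \<in> X \<rightarrow> carrier N"
            using c semimodule_hom_closed[OF h basis_vector_closed]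
            by (intro Pi_I N.smult_closed) auto
        qed (simp_all add: linear_combination_basis_vector[OF L X gL] \<phi>g)
      qed
      also have "\<dots> = (\<alpha> \<circ> p) c"
        by (rule free_semimodule_hom_eq[OF N X h c, symmetric])
      finally show ?thesis by simp
    qed
    show ?thesis
    proof
      show "?l \<circ> i \<in> semimodule_hom R M L" by (rule semimodule_hom_comp[OF i l])
      show "\<forall>x\<in>carrier M. \<phi> ((?l \<circ> i) x) = \<alpha> x"
        using pi by (simp add: \<phi>l semimodule_hom_closed[OF i] del: carrier_free_semimodule)
    qed
  qed
  then show ?thesis unfolding projective_semimodule_def by blast
qed

text \<open>The canonical surjection from the free semimodule on the elements of \<open>M\<close>
  splits.\<close>

lemma projective_imp_finite_free_retract:
  assumes "projective_semimodule TYPE('v) R M" and "infinite (UNIV :: 'v set)"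
    and M: "semimodule R M" and fin: "finite (carrier R)" "finite (carrier M)"
  shows "finite_free_retract M (carrier M)"
proof -
  let ?l = "linear_combination M (carrier M) (\<lambda>x. x)"
    and ?F = "free_semimodule R (carrier M)"
  have l: "?l \<in> semimodule_hom R ?F M"
    by (rule linear_combination_hom[OF M]) simp
  obtain s where "s \<in> semimodule_hom R M ?F" "\<forall>x\<in>carrier M. ?l (s x) = x"
    using projective_semimodule_split[OF assms(1-3) fin(2) free_semimodule
        finite_free_semimodule[OF fin(2,1)] l linear_combination_surj[OF M fin(2)]] ..
  with l fin(2) show ?thesis unfolding finite_free_retract_def by blast
qed

end

section \<open>Functionals over involutive semirings\<close>

context bounded_involutive_semiring
begin

lemma add_le_zero_iff: "x \<in> carrier A \<Longrightarrow> add_le A x \<zero> \<longleftrightarrow> x = \<zero>"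
  by (simp add: add_le_def)

text \<open>The order is visible in annihilators: \<open>x \<le> y\<close> means that
  \<open>lneg A y\<close> annihilates \<open>x\<close> from the left. Since \<open>lneg A d\<close>
  annihilates \<open>d\<close>, it annihilates \<open>c\<close>, so \<open>c \<le> d\<close>; the
  converse is symmetric.\<close>

lemma left_annihilator_inject:
  assumes cd: "c \<in> carrier A" "d \<in> carrier A"
    and "\<And>a. a \<in> carrier A \<Longrightarrow> a \<otimes> c = \<zero> \<longleftrightarrow> a \<otimes> d = \<zero>"
  shows "c = d"
proof -
  have le: "add_le A x y \<longleftrightarrow> lneg A y \<otimes> x = \<zero>"
    if "x \<in> carrier A" "y \<in> carrier A" for x y
    using le_iff_lneg[OF that] add_le_zero_iff that lneg_closed by simp
  have "add_le A x x" if "x \<in> carrier A" for x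
    using that by (simp add: add_le_def join_idem)
  then have "add_le A c d" "add_le A d c"
    using assms le lneg_closed by metis+
  then show ?thesis
    using cd join_comm by (simp add: add_le_def)
qed

text \<open>Both elements lie below their join, and only zero lies below zero.\<close>

lemma join_eq_zero_iff:
  assumes "x \<in> carrier A" "y \<in> carrier A"
  shows "x \<oplus> y = \<zero> \<longleftrightarrow> x = \<zero> \<and> y = \<zero>"
proof
  assume xy: "x \<oplus> y = \<zero>"
  have "x \<oplus> (x \<oplus> y) = x \<oplus> y" "(x \<oplus> y) \<oplus> y = x \<oplus> y"
    using assms by (simp_all add: join_idem join_assoc flip: join_assoc[of x x y])
  with xy show "x = \<zero> \<and> y = \<zero>" using assms by simp
qed (use assms in simp)

text \<open>Idempotence comes from \<open>1 + 1 = 1\<close> in \<open>A\<close>. Hence every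
  semimodule is a join-semilattice, ordered by \<open>x + y = y\<close>.\<close>

lemma semimodule_add_idem:
  assumes "semimodule A M" and "x \<in> carrier M"
  shows "x \<oplus>\<^bsub>M\<^esub> x = x"
proof -
  interpret M: semimodule A M by fact
  show ?thesis
    using M.smult_l_distr[of \<one> \<one> x] assms(2) by (simp add: join_idem)
qed

lemma add_le_finsum:
  assumes "finite S" "S \<subseteq> carrier A" "a \<in> S"
  shows "add_le A a (\<Oplus>s\<in>S. s)"
proof -
  have S: "(\<Oplus>s\<in>S - {a}. s) \<in> carrier A" "a \<in> carrier A"
    using assms by (auto intro!: finsum_closed)
  have "(\<Oplus>s\<in>S. s) = (\<Oplus>s\<in>insert a (S - {a}). s)" using assms by (simp add: insert_absorb)
  also have "\<dots> = a \<oplus> (\<Oplus>s\<in>S - {a}. s)" using assms by (intro finsum_insert) auto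
  finally show ?thesis
    using S by (simp add: add_le_def join_idem flip: join_assoc)
qed

text \<open>
  The functional sends \<open>x\<close> to \<open>\<sim>p\<close>, where \<open>p\<close> is the largest scalar with \<open>px \<in> K\<close>.
\<close>

lemma ex_functional:
  assumes M: "semimodule A M" and fin: "finite (carrier A)"
    and K: "subsemimodule A M K"
    and down: "\<And>x y. \<lbrakk>x \<in> carrier M; y \<in> K; x \<oplus>\<^bsub>M\<^esub> y = y\<rbrakk> \<Longrightarrow> x \<in> K"
  shows "\<exists>f \<in> semimodule_hom A M (regular_semimodule A).
    \<forall>a\<in>carrier A. \<forall>x\<in>carrier M. a \<otimes> f x = \<zero> \<longleftrightarrow> a \<odot>\<^bsub>M\<^esub> x \<in> K"
proof -
  interpret M: semimodule A M by fact
  define I where "I x = {a \<in> carrier A. a \<odot>\<^bsub>M\<^esub> x \<in> K}" for x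
  define p where "p x = (\<Oplus>a\<in>I x. a)" for x
  have zK: "\<zero>\<^bsub>M\<^esub> \<in> K" and KM: "K \<subseteq> carrier M"
    and addK: "\<And>x y. \<lbrakk>x \<in> K; y \<in> K\<rbrakk> \<Longrightarrow> x \<oplus>\<^bsub>M\<^esub> y \<in> K"
    and smK: "\<And>a x. \<lbrakk>a \<in> carrier A; x \<in> K\<rbrakk> \<Longrightarrow> a \<odot>\<^bsub>M\<^esub> x \<in> K"
    using K by (auto simp: subsemimodule_def)
  \<comment> \<open>By idempotence each summand lies below the sum, so downward closure recovers the
    summands from the sum.\<close>
  have add_in_K: "x \<oplus>\<^bsub>M\<^esub> y \<in> K \<longleftrightarrow> x \<in> K \<and> y \<in> K"
    if xy: "x \<in> carrier M" "y \<in> carrier M" for x y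
  proof
    assume "x \<oplus>\<^bsub>M\<^esub> y \<in> K"
    moreover have "x \<oplus>\<^bsub>M\<^esub> (x \<oplus>\<^bsub>M\<^esub> y) = x \<oplus>\<^bsub>M\<^esub> y"
      using xy by (simp add: semimodule_add_idem[OF M] flip: M.M.a_assoc)
    moreover have "y \<oplus>\<^bsub>M\<^esub> (x \<oplus>\<^bsub>M\<^esub> y) = x \<oplus>\<^bsub>M\<^esub> y"
      using xy by (simp add: semimodule_add_idem[OF M] M.M.a_lcomm)
    ultimately show "x \<in> K \<and> y \<in> K" using xy down by blast
  qed (use addK in blast)
  have pA: "p x \<in> carrier A" for x
    unfolding p_def by (rule finsum_closed) (auto simp: I_def)
  \<comment> \<open>The scalars carrying \<open>x\<close> into \<open>K\<close> are closed under
    finite joins, so their join \<open>p x\<close> is one of them.\<close>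
  have pK: "p x \<odot>\<^bsub>M\<^esub> x \<in> K" if x: "x \<in> carrier M" for x
  proof -
    have "finite S \<Longrightarrow> S \<subseteq> I x \<Longrightarrow> (\<Oplus>a\<in>S. a) \<in> I x" for S
    proof (induction S rule: finite_induct)
      case (insert a S)
      then have "a \<in> I x" "(\<Oplus>a\<in>S. a) \<in> I x" "(\<Oplus>a\<in>insert a S. a) = a \<oplus> (\<Oplus>a\<in>S. a)"
        by (auto simp: I_def intro!: finsum_insert)
      then show ?case using x addK by (auto simp: I_def M.smult_l_distr)
    qed (use x zK in \<open>simp add: I_def\<close>)
    moreover have "finite (I x)" using fin by (simp add: I_def)
    ultimately show ?thesis unfolding p_def by (auto simp: I_def)
  qed
  \<comment> \<open>Both conditions say \<open>a \<le> p x\<close>: the first by the axiom for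
    \<open>rneg\<close>, the second because \<open>p x\<close> is the largest scalar carrying
    \<open>x\<close> into \<open>K\<close> and \<open>K\<close> is closed downwards.\<close>
  have ann: "a \<otimes> rneg A (p x) = \<zero> \<longleftrightarrow> a \<odot>\<^bsub>M\<^esub> x \<in> K"
    if a: "a \<in> carrier A" and x: "x \<in> carrier M" for a x
  proof -
    have "a \<otimes> rneg A (p x) = \<zero> \<longleftrightarrow> add_le A a (p x)"
      using le_iff_rneg[OF a pA] add_le_zero_iff a rneg_closed[OF pA] by simp
    also have "\<dots> \<longleftrightarrow> a \<odot>\<^bsub>M\<^esub> x \<in> K"
    proof
      assume "add_le A a (p x)"
      then have "a \<odot>\<^bsub>M\<^esub> x \<oplus>\<^bsub>M\<^esub> p x \<odot>\<^bsub>M\<^esub> x = p x \<odot>\<^bsub>M\<^esub> x"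
        using a x pA by (simp add: add_le_def flip: M.smult_l_distr)
      then show "a \<odot>\<^bsub>M\<^esub> x \<in> K" using down[OF _ pK[OF x]] a x by simp
    next
      assume "a \<odot>\<^bsub>M\<^esub> x \<in> K"
      then show "add_le A a (p x)"
        unfolding p_def using a fin by (intro add_le_finsum) (auto simp: I_def)
    qed
    finally show ?thesis .
  qed
  have nA: "rneg A (p x) \<in> carrier A" for x by (rule rneg_closed[OF pA])
  have "(\<lambda>x. rneg A (p x)) \<in> semimodule_hom A M (regular_semimodule A)"
  proof (rule semimodule_homI)
    fix x y assume xy: "x \<in> carrier M" "y \<in> carrier M"
    \<comment> \<open>By \<open>ann\<close>, a scalar \<open>a\<close> annihilates either side
      exactly when \<open>a x\<close> and \<open>a y\<close> both lie in \<open>K\<close>.\<close>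
    have "rneg A (p (x \<oplus>\<^bsub>M\<^esub> y)) = rneg A (p x) \<oplus> rneg A (p y)"
      by (rule left_annihilator_inject)
        (use xy nA in \<open>simp_all add: ann r_distr join_eq_zero_iff M.smult_r_distr add_in_K\<close>)
    then show "rneg A (p (x \<oplus>\<^bsub>M\<^esub> y)) =
        rneg A (p x) \<oplus>\<^bsub>regular_semimodule A\<^esub> rneg A (p y)" by simp
  next
    fix b x assume bx: "b \<in> carrier A" "x \<in> carrier M"
    \<comment> \<open>A scalar \<open>a\<close> annihilates either side exactly when
      \<open>(a b) x\<close> lies in \<open>K\<close>.\<close>
    have "rneg A (p (b \<odot>\<^bsub>M\<^esub> x)) = b \<otimes> rneg A (p x)"
      by (rule left_annihilator_inject)
        (use bx nA in \<open>simp_all add: ann flip: m_assoc M.smult_assoc\<close>)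
    then show "rneg A (p (b \<odot>\<^bsub>M\<^esub> x)) = b \<odot>\<^bsub>regular_semimodule A\<^esub> rneg A (p x)" by simp
  qed (simp add: nA)
  then show ?thesis by (rule bexI[rotated]) (simp add: ann)
qed

section \<open>Injectivity of the regular semimodule and of finite free retracts\<close>

text \<open>The functional \<open>f\<close> belonging to \<open>K\<close>, the downward closure of
  the kernel of \<open>\<alpha>\<close>, is the extension: for \<open>x\<close> in \<open>N\<close>,
  both \<open>a (f x) = 0\<close> and \<open>a (\<alpha> x) = 0\<close> mean that \<open>a x\<close>
  lies in \<open>K\<close>, so \<open>f x\<close> and \<open>\<alpha> x\<close> have the same left
  annihilator.\<close>

lemma regular_semimodule_extend:
  assumes M: "semimodule A M" and fin: "finite (carrier A)" and N: "subsemimodule A M N"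
    and \<alpha>: "\<alpha> \<in> semimodule_hom A (M\<lparr>carrier := N\<rparr>) (regular_semimodule A)"
  shows "\<exists>\<beta> \<in> semimodule_hom A M (regular_semimodule A). \<forall>x\<in>N. \<beta> x = \<alpha> x"
proof -
  interpret M: semimodule A M by fact
  have NM: "N \<subseteq> carrier M" and zN: "\<zero>\<^bsub>M\<^esub> \<in> N"
    and addN: "\<And>x y. \<lbrakk>x \<in> N; y \<in> N\<rbrakk> \<Longrightarrow> x \<oplus>\<^bsub>M\<^esub> y \<in> N"
    and smN: "\<And>a x. \<lbrakk>a \<in> carrier A; x \<in> N\<rbrakk> \<Longrightarrow> a \<odot>\<^bsub>M\<^esub> x \<in> N"
    using N by (auto simp: subsemimodule_def)
  have \<alpha>A: "\<alpha> x \<in> carrier A" if "x \<in> N" for x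
    using semimodule_hom_closed[OF \<alpha>] that by simp
  have \<alpha>_add: "\<alpha> (x \<oplus>\<^bsub>M\<^esub> y) = \<alpha> x \<oplus> \<alpha> y" if "x \<in> N" "y \<in> N" for x y
    using semimodule_hom_add[OF \<alpha>] that by simp
  have \<alpha>_smult: "\<alpha> (a \<odot>\<^bsub>M\<^esub> x) = a \<otimes> \<alpha> x" if "a \<in> carrier A" "x \<in> N" for a x
    using semimodule_hom_smult[OF \<alpha>] that by simp
  have \<alpha>_zero: "\<alpha> \<zero>\<^bsub>M\<^esub> = \<zero>"
    using \<alpha>_smult[of \<zero> "\<zero>\<^bsub>M\<^esub>"] zN \<alpha>A by simp
  define K where "K = {m \<in> carrier M. \<exists>k\<in>N. \<alpha> k = \<zero> \<and> m \<oplus>\<^bsub>M\<^esub> k = k}"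
  have KI: "m \<in> K" if "m \<in> carrier M" "k \<in> N" "\<alpha> k = \<zero>" "m \<oplus>\<^bsub>M\<^esub> k = k" for m k
    using that by (auto simp: K_def)
  have K_sub: "subsemimodule A M K"
    unfolding subsemimodule_def
  proof (intro conjI ballI)
    show "K \<subseteq> carrier M" by (auto simp: K_def)
    show "\<zero>\<^bsub>M\<^esub> \<in> K" by (rule KI[of _ "\<zero>\<^bsub>M\<^esub>"]) (use zN \<alpha>_zero in auto)
  next
    fix x y assume "x \<in> K" "y \<in> K"
    then obtain k l where k: "x \<in> carrier M" "k \<in> N" "\<alpha> k = \<zero>" "x \<oplus>\<^bsub>M\<^esub> k = k"
      and l: "y \<in> carrier M" "l \<in> N" "\<alpha> l = \<zero>" "y \<oplus>\<^bsub>M\<^esub> l = l" by (auto simp: K_def)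
    have "(x \<oplus>\<^bsub>M\<^esub> y) \<oplus>\<^bsub>M\<^esub> (k \<oplus>\<^bsub>M\<^esub> l) = (x \<oplus>\<^bsub>M\<^esub> k) \<oplus>\<^bsub>M\<^esub> (y \<oplus>\<^bsub>M\<^esub> l)"
      using k(1,2) l(1,2) NM by (simp add: M.M.a_ac subset_iff)
    then show "x \<oplus>\<^bsub>M\<^esub> y \<in> K"
      using k l addN \<alpha>_add by (intro KI[of _ "k \<oplus>\<^bsub>M\<^esub> l"]) simp_all
  next
    fix a x assume a: "a \<in> carrier A" and "x \<in> K"
    then obtain k where k: "x \<in> carrier M" "k \<in> N" "\<alpha> k = \<zero>" "x \<oplus>\<^bsub>M\<^esub> k = k"
      by (auto simp: K_def)
    have "a \<odot>\<^bsub>M\<^esub> x \<oplus>\<^bsub>M\<^esub> a \<odot>\<^bsub>M\<^esub> k = a \<odot>\<^bsub>M\<^esub> k"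
      using a k NM by (metis M.smult_r_distr subsetD)
    then show "a \<odot>\<^bsub>M\<^esub> x \<in> K"
      using a k smN \<alpha>_smult by (intro KI[of _ "a \<odot>\<^bsub>M\<^esub> k"]) simp_all
  qed
  have K_down: "x \<in> K" if xy: "x \<in> carrier M" "y \<in> K" "x \<oplus>\<^bsub>M\<^esub> y = y" for x y
  proof -
    obtain k where k: "y \<in> carrier M" "k \<in> N" "\<alpha> k = \<zero>" "y \<oplus>\<^bsub>M\<^esub> k = k"
      using xy(2) by (auto simp: K_def)
    have "x \<oplus>\<^bsub>M\<^esub> k = (x \<oplus>\<^bsub>M\<^esub> y) \<oplus>\<^bsub>M\<^esub> k"
      using xy(1) k(1,2,4) NM by (simp add: M.M.a_assoc subset_iff)
    then show ?thesis using xy k by (intro KI[of _ k]) simp_all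
  qed
  \<comment> \<open>The downward closure adds no element of \<open>N\<close> to the kernel: if
    \<open>x \<le> k\<close> with both in \<open>N\<close> and \<open>\<alpha> k = 0\<close>, then
    \<open>\<alpha> x \<le> 0\<close>.\<close>
  have K_iff: "x \<in> K \<longleftrightarrow> \<alpha> x = \<zero>" if x: "x \<in> N" for x
  proof
    assume "x \<in> K"
    then obtain k where k: "k \<in> N" "\<alpha> k = \<zero>" "x \<oplus>\<^bsub>M\<^esub> k = k" by (auto simp: K_def)
    then show "\<alpha> x = \<zero>" using \<alpha>_add[OF x k(1)] \<alpha>A[OF x] by simp
  next
    assume "\<alpha> x = \<zero>"
    then show "x \<in> K" using x NM semimodule_add_idem[OF M] by (intro KI[of _ x]) auto
  qed
  have "\<exists>f \<in> semimodule_hom A M (regular_semimodule A).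
      \<forall>a\<in>carrier A. \<forall>x\<in>carrier M. a \<otimes> f x = \<zero> \<longleftrightarrow> a \<odot>\<^bsub>M\<^esub> x \<in> K"
    by (rule ex_functional[OF M fin K_sub]) (rule K_down)
  then obtain f where f: "f \<in> semimodule_hom A M (regular_semimodule A)"
    and fK: "\<forall>a\<in>carrier A. \<forall>x\<in>carrier M. a \<otimes> f x = \<zero> \<longleftrightarrow> a \<odot>\<^bsub>M\<^esub> x \<in> K" ..
  have "f x = \<alpha> x" if x: "x \<in> N" for x
  proof (rule left_annihilator_inject)
    show "f x \<in> carrier A" "\<alpha> x \<in> carrier A"
      using semimodule_hom_closed[OF f] x NM \<alpha>A by auto
    show "a \<otimes> f x = \<zero> \<longleftrightarrow> a \<otimes> \<alpha> x = \<zero>" if "a \<in> carrier A" for a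
      using fK that x NM K_iff smN \<alpha>_smult by auto
  qed
  with f show ?thesis by blast
qed

text \<open>Each coordinate of \<open>i \<circ> \<alpha>\<close> is a functional on \<open>N\<close>
  and extends; the extensions assemble to a map into the free semimodule, and \<open>p\<close>
  brings it back to \<open>M\<close>.\<close>

lemma finite_free_retract_imp_injective:
  assumes "finite_free_retract M X" and fin: "finite (carrier A)"
  shows "injective_semimodule TYPE('u) A M"
proof -
  let ?F = "free_semimodule A X"
  obtain i p where i: "i \<in> semimodule_hom A M ?F" and p: "p \<in> semimodule_hom A ?F M"
    and pi: "\<forall>x\<in>carrier M. p (i x) = x"
    using assms(1) by (auto simp: finite_free_retract_def)
  have "\<exists>\<beta> \<in> semimodule_hom A L M. \<forall>x\<in>N. \<beta> x = \<alpha> x"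
    if L: "semimodule A L" and N: "subsemimodule A L N"
      and \<alpha>: "\<alpha> \<in> semimodule_hom A (L\<lparr>carrier := N\<rparr>) M"
    for L :: "('a, 'u) module" and N \<alpha>
  proof -
    have "\<exists>\<beta> \<in> semimodule_hom A L (regular_semimodule A). \<forall>n\<in>N. \<beta> n = i (\<alpha> n) x"
      if "x \<in> X" for x
      using regular_semimodule_extend[OF L fin N semimodule_hom_comp[OF
            semimodule_hom_comp[OF \<alpha> i] free_semimodule_coordinate[OF that]]]
      by simp
    then obtain b where b: "\<And>x. x \<in> X \<Longrightarrow> b x \<in> semimodule_hom A L (regular_semimodule A)"
      and b_ext: "\<And>x n. \<lbrakk>x \<in> X; n \<in> N\<rbrakk> \<Longrightarrow> b x n = i (\<alpha> n) x"
      by metis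
    define \<beta> where "\<beta> = (\<lambda>m. \<lambda>x\<in>X. b x m)"
    have \<beta>: "\<beta> \<in> semimodule_hom A L ?F"
      unfolding \<beta>_def by (rule free_semimodule_homI) (use b in simp)
    have "\<beta> n = i (\<alpha> n)" "p (i (\<alpha> n)) = \<alpha> n" if n: "n \<in> N" for n
    proof -
      have \<alpha>n: "\<alpha> n \<in> carrier M" using semimodule_hom_closed[OF \<alpha>] n by simp
      then show "p (i (\<alpha> n)) = \<alpha> n" using pi by blast
      show "\<beta> n = i (\<alpha> n)"
      proof (rule PiE_ext)
        show "\<beta> n \<in> X \<rightarrow>\<^sub>E carrier A"
          using semimodule_hom_closed[OF \<beta>] n N by (auto simp: subsemimodule_def)
        show "i (\<alpha> n) \<in> X \<rightarrow>\<^sub>E carrier A"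
          using semimodule_hom_closed[OF i \<alpha>n] by simp
      qed (use n b_ext in \<open>simp add: \<beta>_def\<close>)
    qed
    then have "\<forall>x\<in>N. (p \<circ> \<beta>) x = \<alpha> x" by simp
    with semimodule_hom_comp[OF \<beta> p] show ?thesis by blast
  qed
  then show ?thesis unfolding injective_semimodule_def by blast
qed

section \<open>Embedding into a free semimodule\<close>

text \<open>Closure under scalars is the point: \<open>a \<le> 1\<close> gives
  \<open>a x \<le> x\<close>, so scaling never leaves a downset.\<close>

lemma subsemimodule_downset:
  assumes M: "semimodule A M" and y: "y \<in> carrier M"
  shows "subsemimodule A M {x \<in> carrier M. x \<oplus>\<^bsub>M\<^esub> y = y}"
proof -
  interpret M: semimodule A M by fact
  have "a \<odot>\<^bsub>M\<^esub> x \<oplus>\<^bsub>M\<^esub> y = y"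
    if a: "a \<in> carrier A" and x: "x \<in> carrier M" "x \<oplus>\<^bsub>M\<^esub> y = y" for a x
  proof -
    have ax: "a \<odot>\<^bsub>M\<^esub> x \<oplus>\<^bsub>M\<^esub> x = x"
      using le_one[OF a] M.smult_l_distr[OF a one_closed x(1)] x(1) by (simp add: add_le_def)
    have "a \<odot>\<^bsub>M\<^esub> x \<oplus>\<^bsub>M\<^esub> y = (a \<odot>\<^bsub>M\<^esub> x \<oplus>\<^bsub>M\<^esub> x) \<oplus>\<^bsub>M\<^esub> y"
      using a x y by (simp add: M.M.a_assoc)
    then show ?thesis by (simp add: ax x)
  qed
  then show ?thesis
    using y by (auto simp: subsemimodule_def M.M.a_assoc)
qed

text \<open>One coordinate is used for each \<open>y\<close>, namely a functional vanishing exactly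
  on the elements below \<open>y\<close>. These functionals separate points because the order on
  \<open>M\<close> is antisymmetric.\<close>

lemma ex_free_semimodule_embedding:
  assumes M: "semimodule A M" and fin: "finite (carrier A)"
  shows "\<exists>i \<in> semimodule_hom A M (free_semimodule A (carrier M)). inj_on i (carrier M)"
proof -
  interpret M: semimodule A M by fact
  have "\<exists>f \<in> semimodule_hom A M (regular_semimodule A).
      \<forall>x\<in>carrier M. f x = \<zero> \<longleftrightarrow> x \<oplus>\<^bsub>M\<^esub> y = y" if y: "y \<in> carrier M" for y
  proof -
    let ?K = "{x \<in> carrier M. x \<oplus>\<^bsub>M\<^esub> y = y}"
    have down: "x \<in> ?K" if "x \<in> carrier M" "z \<in> ?K" "x \<oplus>\<^bsub>M\<^esub> z = z" for x z
      using that y M.M.a_assoc[of x z y] by simp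
    have "\<exists>f \<in> semimodule_hom A M (regular_semimodule A).
        \<forall>a\<in>carrier A. \<forall>x\<in>carrier M. a \<otimes> f x = \<zero> \<longleftrightarrow> a \<odot>\<^bsub>M\<^esub> x \<in> ?K"
      by (rule ex_functional[OF M fin subsemimodule_downset[OF M y]]) (rule down)
    then obtain f where f: "f \<in> semimodule_hom A M (regular_semimodule A)"
      and fK: "\<forall>a\<in>carrier A. \<forall>x\<in>carrier M. a \<otimes> f x = \<zero> \<longleftrightarrow> a \<odot>\<^bsub>M\<^esub> x \<in> ?K" ..
    \<comment> \<open>This is the annihilator condition for the scalar \<open>1\<close>.\<close>
    have "f x = \<zero> \<longleftrightarrow> x \<oplus>\<^bsub>M\<^esub> y = y" if "x \<in> carrier M" for x
      using fK[rule_format, OF one_closed that] semimodule_hom_closed[OF f that] that by simp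
    with f show ?thesis by blast
  qed
  then obtain f
    where f: "\<And>y. y \<in> carrier M \<Longrightarrow> f y \<in> semimodule_hom A M (regular_semimodule A)"
      and f0: "\<And>x y. \<lbrakk>y \<in> carrier M; x \<in> carrier M\<rbrakk> \<Longrightarrow> f y x = \<zero> \<longleftrightarrow> x \<oplus>\<^bsub>M\<^esub> y = y"
    by metis
  define i where "i = (\<lambda>x. \<lambda>y\<in>carrier M. f y x)"
  have "inj_on i (carrier M)"
  proof (rule inj_onI)
    fix x y assume xy: "x \<in> carrier M" "y \<in> carrier M" "i x = i y"
    have "f z x = f z y" if "z \<in> carrier M" for z
      using fun_cong[OF xy(3), of z] that by (simp add: i_def)
    \<comment> \<open>The functional \<open>f y\<close> vanishes at \<open>y\<close>, hence also at
      \<open>x\<close>, which gives \<open>x \<le> y\<close>; \<open>f x\<close> gives the other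
      inequality.\<close>
    then have "x \<oplus>\<^bsub>M\<^esub> y = y" "y \<oplus>\<^bsub>M\<^esub> x = x"
      using f0 xy(1,2) semimodule_add_idem[OF M] by metis+
    then show "x = y" using xy M.M.a_comm by metis
  qed
  moreover have "i \<in> semimodule_hom A M (free_semimodule A (carrier M))"
    unfolding i_def by (rule free_semimodule_homI) (use f in simp)
  ultimately show ?thesis by blast
qed

text \<open>The embedding into the free semimodule on the elements of \<open>M\<close> splits, as
  that semimodule is finite and so fits into \<open>'u\<close>.\<close>

lemma injective_imp_finite_free_retract:
  assumes "injective_semimodule TYPE('u) A M" and "infinite (UNIV :: 'u set)"
    and M: "semimodule A M" and fin: "finite (carrier A)" "finite (carrier M)"
  shows "finite_free_retract M (carrier M)"
proof -
  let ?F = "free_semimodule A (carrier M)"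
  obtain i where i: "i \<in> semimodule_hom A M ?F" "inj_on i (carrier M)"
    using ex_free_semimodule_embedding[OF M fin(1)] by blast
  obtain r where "r \<in> semimodule_hom A ?F M" "\<forall>x\<in>carrier M. r (i x) = x"
    using injective_semimodule_split[OF assms(1-3) free_semimodule
        finite_free_semimodule[OF fin(2,1)] i] ..
  with i(1) fin(2) show ?thesis unfolding finite_free_retract_def by blast
qed

end

theorem theorem12:
  fixes A :: "('a, 'r) inv_semiring_scheme"
    and M :: "('a, 'm, 's) module_scheme"
  assumes "bounded_involutive_semiring A"
    and "finite (carrier A)"
    and "semimodule A M"
    and "finitely_generated A M"
    and "infinite (UNIV :: 'u set)"
    and "infinite (UNIV :: 'v set)"
  shows "injective_semimodule TYPE('u) A M \<longleftrightarrow> projective_semimodule TYPE('v) A M"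
proof -
  interpret A: bounded_involutive_semiring A by fact
  have fin: "finite (carrier M)"
    by (rule A.finitely_generated_imp_finite[OF assms(3,4,2)])
  show ?thesis
  proof
    assume "injective_semimodule TYPE('u) A M"
    then have "A.finite_free_retract M (carrier M)"
      by (rule A.injective_imp_finite_free_retract) fact+
    then show "projective_semimodule TYPE('v) A M"
      by (rule A.finite_free_retract_imp_projective)
  next
    assume "projective_semimodule TYPE('v) A M"
    then have "A.finite_free_retract M (carrier M)"
      by (rule A.projective_imp_finite_free_retract) fact+
    then show "injective_semimodule TYPE('u) A M"
      using assms(2) by (rule A.finite_free_retract_imp_injective)
  qed
qed

end
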